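(* Any directed graph $G$ on $n$ vertices with positive capacities, a designated source vertex $s$ and a designated sink vertex $t$, can be preprocessed to assign each vertex a label of $\mathcal{O}(\log^2 n+\log n\log W)$ bits such that, given any edge $e=(x,y)$ of $G$ and any value $\Delta\ge -w(e)$, the capacity of the $(s,t)$-mincut after changing the capacity of $e$ from $w(e)$ to $w(e)+\Delta$ can be determined in polylogarithmic time by processing only the labels of $x$ and $y$. Here $W$ is the maximum capacity of an edge of $G$.
   Context: An $(s,t)$-cut is a set $C$ of vertices with $s\in C$, $t\notin C$; its capacity is the total capacity of edges from $C$ to its complement; the $(s,t)$-mincut capacity is the minimum capacity of an $(s,t)$-cut.
   Formalization: Capacities are taken to be positive integers and Δ an integer, since the bit bound in terms of log W fails for arbitrary real capacities; time is counted in steps of a word RAM whose words hold O(log n + log W) bits and Δ. *)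

theory Defs
  imports Complex_Main "HOL-Library.Log_Nat" "Graph_Theory.Pair_Digraph"
begin

section \<open>Cuts of capacitated digraphs\<close>

text \<open>Capacities are given as a function on arcs; only its values on \<open>parcs G\<close> matter.\<close>

definition st_cut :: "'a pair_pre_digraph \<Rightarrow> 'a \<Rightarrow> 'a \<Rightarrow> 'a set \<Rightarrow> bool" where
  "st_cut G s t C \<longleftrightarrow> C \<subseteq> pverts G \<and> s \<in> C \<and> t \<notin> C"

definition cut_capacity :: "'a pair_pre_digraph \<Rightarrow> ('a \<times> 'a \<Rightarrow> nat) \<Rightarrow> 'a set \<Rightarrow> nat" where
  "cut_capacity G w C = (\<Sum>e \<in> {e \<in> parcs G. fst e \<in> C \<and> snd e \<in> pverts G - C}. w e)"

definition mincut_capacity ::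
  "'a pair_pre_digraph \<Rightarrow> ('a \<times> 'a \<Rightarrow> nat) \<Rightarrow> 'a \<Rightarrow> 'a \<Rightarrow> nat" where
  "mincut_capacity G w s t = Min (cut_capacity G w ` {C. st_cut G s t C})"

text \<open>Used only for \<open>- int (w e) \<le> \<Delta>\<close>, so that \<open>nat\<close> does not truncate.  A new capacity of
  \<open>0\<close> is allowed; it amounts to deleting \<open>e\<close>.\<close>

definition change_capacity :: "('a \<times> 'a \<Rightarrow> nat) \<Rightarrow> 'a \<times> 'a \<Rightarrow> int \<Rightarrow> 'a \<times> 'a \<Rightarrow> nat" where
  "change_capacity w e \<Delta> = w(e := nat (int (w e) + \<Delta>))"


section \<open>A unit-cost word RAM\<close>

text \<open>
  The machine has word size \<open>k\<close>: every register and every memory cell holds a number below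
  \<open>2 ^ k\<close>, and each instruction takes one time step.  Arithmetic is modulo \<open>2 ^ k\<close>.
  Register numbers and jump targets are constants of the program; memory addresses are words.
  A program is a fixed finite list of instructions, independent of \<open>k\<close> and of the input.
\<close>

datatype instr =
    Const nat nat        \<comment> \<open>\<open>Const i c\<close>: register \<open>i\<close> becomes \<open>c\<close>\<close>
  | Add nat nat nat      \<comment> \<open>\<open>Add i j l\<close>: register \<open>i\<close> becomes the sum of \<open>j\<close> and \<open>l\<close>\<close>
  | Sub nat nat nat      \<comment> \<open>\<open>Sub i j l\<close>: register \<open>i\<close> becomes \<open>j\<close> minus \<open>l\<close>\<close>
  | Load nat nat         \<comment> \<open>\<open>Load i j\<close>: register \<open>i\<close> becomes the cell addressed by \<open>j\<close>\<close>
  | Store nat nat        \<comment> \<open>\<open>Store i j\<close>: the cell addressed by \<open>i\<close> becomes register \<open>j\<close>\<close>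
  | JumpLess nat nat nat \<comment> \<open>\<open>JumpLess i j l\<close>: go to \<open>l\<close> if register \<open>i\<close> is below register \<open>j\<close>\<close>

record ram_state =
  pc :: nat
  reg :: "nat \<Rightarrow> nat"
  mem :: "nat \<Rightarrow> nat"

fun exec :: "nat \<Rightarrow> instr \<Rightarrow> ram_state \<Rightarrow> ram_state" where
  "exec k (Const i c) \<sigma> = \<sigma>\<lparr>pc := Suc (pc \<sigma>), reg := (reg \<sigma>)(i := take_bit k c)\<rparr>"
| "exec k (Add i j l) \<sigma> =
    \<sigma>\<lparr>pc := Suc (pc \<sigma>), reg := (reg \<sigma>)(i := take_bit k (reg \<sigma> j + reg \<sigma> l))\<rparr>"
| "exec k (Sub i j l) \<sigma> =
    \<sigma>\<lparr>pc := Suc (pc \<sigma>), reg := (reg \<sigma>)(i := take_bit k (reg \<sigma> j + 2 ^ k - reg \<sigma> l))\<rparr>"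
| "exec k (Load i j) \<sigma> = \<sigma>\<lparr>pc := Suc (pc \<sigma>), reg := (reg \<sigma>)(i := mem \<sigma> (reg \<sigma> j))\<rparr>"
| "exec k (Store i j) \<sigma> = \<sigma>\<lparr>pc := Suc (pc \<sigma>), mem := (mem \<sigma>)(reg \<sigma> i := reg \<sigma> j)\<rparr>"
| "exec k (JumpLess i j l) \<sigma> =
    \<sigma>\<lparr>pc := (if reg \<sigma> i < reg \<sigma> j then l else Suc (pc \<sigma>))\<rparr>"

text \<open>The machine halts by leaving the program text.\<close>

definition step :: "nat \<Rightarrow> instr list \<Rightarrow> ram_state \<Rightarrow> ram_state" where
  "step k P \<sigma> = (if pc \<sigma> < length P then exec k (P ! pc \<sigma>) \<sigma> else \<sigma>)"

text \<open>\<open>P\<close>, started in \<open>\<sigma>\<close>, has halted after \<open>T\<close> steps with \<open>v\<close> in register \<open>0\<close>.\<close>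

definition outputs :: "nat \<Rightarrow> instr list \<Rightarrow> ram_state \<Rightarrow> nat \<Rightarrow> nat \<Rightarrow> bool" where
  "outputs k P \<sigma> T v \<longleftrightarrow>
     (let \<sigma>' = (step k P ^^ T) \<sigma> in length P \<le> pc \<sigma>' \<and> reg \<sigma>' 0 = v)"


section \<open>Presenting a query to the machine\<close>

text \<open>A bit string is stored in memory in consecutive blocks of \<open>b\<close> bits, one block per cell,
  least significant bit first; the last block may be shorter.\<close>

definition pack :: "nat \<Rightarrow> bool list \<Rightarrow> nat list" where
  "pack b bs =
     map (\<lambda>i. horner_sum of_bool 2 (take b (drop (i * b) bs))) [0..<(length bs + b - 1) div b]"

text \<open>
  The initial state depends on nothing but the two labels \<open>bx\<close>, \<open>by\<close> and the value \<open>\<Delta>\<close>.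
  The memory holds the blocks of \<open>bx\<close> followed by those of \<open>by\<close>.  Registers \<open>0\<close> and \<open>1\<close> hold
  the numbers of blocks, registers \<open>2\<close> and \<open>3\<close> the positive and the negative part of \<open>\<Delta>\<close>.
\<close>

definition query_state ::
  "nat \<Rightarrow> nat \<Rightarrow> bool list \<Rightarrow> bool list \<Rightarrow> int \<Rightarrow> ram_state" where
  "query_state k b bx by \<Delta> =
     (let rs = [length (pack b bx), length (pack b by), nat \<Delta>, nat (- \<Delta>)];
          ms = pack b bx @ pack b by
      in \<lparr>pc = 0,
          reg = (\<lambda>i. if i < length rs then take_bit k (rs ! i) else 0),
          mem = (\<lambda>i. if i < length ms then take_bit k (ms ! i) else 0)\<rparr>)"

text \<open>
  The number \<open>c * (floorlog 2 n + floorlog 2 W)\<close> of bits in a block, where \<open>floorlog 2 m\<close> is the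
  length of the binary representation of \<open>m\<close>: the usual word length for vertex names and
  capacities up to the constant \<open>c\<close>.
\<close>

definition block_length :: "nat \<Rightarrow> nat \<Rightarrow> nat \<Rightarrow> nat" where
  "block_length c n W = c * (floorlog 2 n + floorlog 2 W)"

end

theory Submission
  imports Defs
begin

text \<open>
  Let \<open>f\<close> be the mincut capacity and \<open>F e\<close> the least capacity of a cut that an arc \<open>e = (x, y)\<close>
  crosses.  A cut not crossed by \<open>e\<close> avoids \<open>x\<close> or contains \<open>y\<close>, so the new mincut is the
  minimum of \<open>F e + \<Delta>\<close> and of two numbers that depend on \<open>x\<close> alone and on \<open>y\<close> alone.  If
  \<open>\<Delta> \<ge> 0\<close>, then \<open>F e\<close> may be replaced by \<open>f\<close>.  If \<open>\<Delta> < 0\<close>, then \<open>F e\<close> matters only for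
  vital arcs, those with \<open>F e < f + w e\<close>.

  By submodularity, no vital arc crosses the optimal cut of a vital arc backwards.  Hence, if these
  optimal cuts are sorted by capacity, then for a vital arc the first cut that separates \<open>x\<close> from
  \<open>y\<close> is crossed forwards and has capacity \<open>F e\<close>; for any other arc, a first separating cut
  crossed forwards has capacity at least \<open>F e\<close>, and one crossed backwards is to be ignored.
  The first separating cut is found from labels with logarithmically many entries: refine the vertex
  set by the cuts one after the other, and let a vertex record a cut only when it falls into the
  smaller part, which halves its block.
\<close>

section \<open>The query program\<close>

type_synonym entry = "nat \<times> nat \<times> nat"

fun entry_cells :: "entry \<Rightarrow> nat list" where
  "entry_cells (i, a, b) = [i, a, b]"

fun entries_at :: "(nat \<Rightarrow> nat) \<Rightarrow> nat \<Rightarrow> entry list \<Rightarrow> bool" where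
  "entries_at m p [] \<longleftrightarrow> True"
| "entries_at m p ((i, a, b) # xs) \<longleftrightarrow>
     m p = i \<and> m (p + 1) = a \<and> m (p + 2) = b \<and> entries_at m (p + 3) xs"

text \<open>While indices agree, index \<open>0\<close> is the only exit of the loop; this condition
  keeps \<open>decode\<close> away from its default equation.\<close>

fun terminated :: "entry list \<Rightarrow> bool" where
  "terminated [] \<longleftrightarrow> False"
| "terminated ((i, a, b) # xs) \<longleftrightarrow> i = 0 \<or> terminated xs"

text \<open>
  An entry \<open>(i, a, b)\<close> records that \<open>i\<close> cuts remained, counting the recorded one; \<open>a\<close> is the answer
  if the vertex is the tail of the query arc, and \<open>b\<close> if it is the head.  The larger index belongs
  to the earlier cut; index \<open>0\<close> ends the list.
\<close>

fun decode :: "entry list \<Rightarrow> entry list \<Rightarrow> nat" where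
  "decode ((i, a, b) # xs) ((j, a', b') # ys) =
     (if j < i then a else if i < j then b' else if 0 < i then decode xs ys else a)"
| "decode _ _ = 0"

text \<open>
  Register \<open>7\<close> holds the running minimum, registers \<open>4\<close> and \<open>0\<close> point into the two labels, and
  the constants \<open>1\<close>, \<open>3\<close> and \<open>0\<close> are in registers \<open>5\<close>, \<open>6\<close> and \<open>9\<close>.  Instructions
  \<open>14\<close> to \<open>20\<close> are the loop that implements \<^const>\<open>decode\<close>.
\<close>

definition query_program :: "instr list" where
  "query_program =
    [Const 5 1,
     Const 6 3,
     Load 7 4,
     Add 7 7 2,
     Load 8 5,
     Sub 8 8 5,
     JumpLess 7 8 8,
     Add 7 8 9,
     Add 8 0 5,
     Add 8 8 5,
     Load 8 8,
     Sub 8 8 5,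
     JumpLess 7 8 14,
     Add 7 8 9,
     Add 4 4 6,
     Add 0 0 6,
     Load 8 4,
     Load 10 0,
     JumpLess 10 8 21,
     JumpLess 8 10 24,
     JumpLess 9 8 14,
     Add 8 4 5,
     Load 8 8,
     JumpLess 9 5 27,
     Add 8 0 5,
     Add 8 8 5,
     Load 8 8,
     Add 8 8 2,
     Sub 8 8 3,
     JumpLess 7 8 31,
     Add 7 8 9,
     Add 0 7 9]"

lemma length_query_program: "length query_program = 32"
  by (simp add: query_program_def)

section \<open>Symbolic execution of the program\<close>

lemma step_query_program:
  "step k query_program \<lparr>pc = i, reg = r, mem = m\<rparr> =
     (if i < 32 then exec k (query_program ! i) \<lparr>pc = i, reg = r, mem = m\<rparr>
      else \<lparr>pc = i, reg = r, mem = m\<rparr>)"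
  by (simp add: step_def length_query_program)

lemma funpow_numeral_swap: "(f ^^ numeral j) x = (f ^^ pred_numeral j) (f x)"
  by (simp add: numeral_eq_Suc funpow_swap1)

text \<open>Unfolds the list only below \<open>!\<close>, so that \<open>query_program\<close> stays
  folded while single instructions are looked up.\<close>

lemmas query_program_nth = arg_cong[OF query_program_def, of "\<lambda>P. P ! i" for i]

lemmas run_simps = step_query_program query_program_nth funpow_numeral_swap

text \<open>This pair of instructions computes a minimum; the program uses it at instructions
  \<open>6\<close>, \<open>12\<close> and \<open>29\<close>.\<close>

lemma min_assign_run:
  assumes "r 9 = 0" "r 7 < 2 ^ k" "r 8 < 2 ^ k"
    and "query_program ! i = JumpLess 7 8 (i + 2)" "query_program ! (i + 1) = Add 7 8 9" "i < 31"
  shows "\<exists>T\<le>2. (step k query_program ^^ T) \<lparr>pc = i, reg = r, mem = m\<rparr> =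
           \<lparr>pc = i + 2, reg = r(7 := min (r 7) (r 8)), mem = m\<rparr>"
proof (cases "r 7 < r 8")
  case True
  then have "r(7 := min (r 7) (r 8)) = r" by auto
  then show ?thesis using assms True
    by (intro exI[of _ 1]) (simp add: run_simps(1))
next
  case False
  then show ?thesis using assms
    by (intro exI[of _ 2]) (simp add: step_query_program funpow_numeral_swap min_def take_bit_nat_eq_self)
qed

lemma funpow_trans:
  assumes "(f ^^ T1) x = y" "(f ^^ T2) y = z"
  shows "(f ^^ (T1 + T2)) x = z"
  using assms by (metis add.commute comp_apply funpow_add)

text \<open>Pointers are advanced before reading, so they start three cells before the entries. A
  full round costs \<open>7\<close> steps; the last one, including the load of the answer, at most
  \<open>10\<close>.\<close>

lemma loop_run:
  assumes "r 5 = 1" "r 6 = 3" "r 9 = 0" "r 4 = p" "r 0 = q"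
    and "entries_at m (p + 3) xs" "entries_at m (q + 3) ys" "terminated xs" "terminated ys"
    and "p + 3 * length xs + 3 < 2 ^ k" "q + 3 * length ys + 3 < 2 ^ k"
  shows "\<exists>T\<le>7 * length xs + 3. \<exists>r'. (step k query_program ^^ T) \<lparr>pc = 14, reg = r, mem = m\<rparr> =
           \<lparr>pc = 27, reg = r', mem = m\<rparr> \<and> r' 8 = decode xs ys \<and>
           r' 2 = r 2 \<and> r' 3 = r 3 \<and> r' 7 = r 7 \<and> r' 9 = 0"
  using assms
proof (induction xs ys arbitrary: r p q rule: decode.induct)
  case (1 i a b xs j a' b' ys)
  have tb: "take_bit k x = x" if "x \<le> p + 5 \<or> x \<le> q + 5" for x
    using that "1.prems"(10,11) by (intro take_bit_nat_eq_self) auto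
  note regs = "1.prems"(1-5)
  have mems: "m (p + 3) = i" "m (q + 3) = j" "m (p + 4) = a" "m (q + 5) = b'"
    using "1.prems"(6,7) by (auto simp: ac_simps)
  have [simp]: "take_bit k (p + 3) = p + 3" "take_bit k (q + 3) = q + 3"
    "take_bit k (4 + p) = p + 4" "take_bit k (4 + q) = q + 4" "take_bit k (5 + q) = q + 5"
    "take_bit k (Suc (p + 3)) = p + 4" "take_bit k (Suc (q + 3)) = q + 4"
    "take_bit k (Suc (q + 4)) = q + 5"
    by (simp_all add: tb)
  show ?case
  proof (cases "j < i")
    case True
    then show ?thesis
      by (intro exI[of _ 8]) (simp add: run_simps regs mems)
  next
    case ji: False
    show ?thesis
    proof (cases "i < j")
      case True
      then show ?thesis
        by (intro exI[of _ 9]) (simp add: run_simps regs mems)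
    next
      case ij: False
      show ?thesis
      proof (cases "0 < i")
        case False
        then show ?thesis using ij ji
          by (intro exI[of _ 10]) (simp add: run_simps regs mems)
      next
        case True
        define r1 where "r1 = r(4 := p + 3, 0 := q + 3, 8 := i, 10 := j)"
        have s1: "(step k query_program ^^ 7) \<lparr>pc = 14, reg = r, mem = m\<rparr> =
            \<lparr>pc = 14, reg = r1, mem = m\<rparr>"
          using True ij ji by (simp add: run_simps regs mems r1_def)
        have "\<exists>T\<le>7 * length xs + 3. \<exists>r'. (step k query_program ^^ T) \<lparr>pc = 14, reg = r1, mem = m\<rparr> =
           \<lparr>pc = 27, reg = r', mem = m\<rparr> \<and> r' 8 = decode xs ys \<and>
           r' 2 = r1 2 \<and> r' 3 = r1 3 \<and> r' 7 = r1 7 \<and> r' 9 = 0"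
          by (rule "1.IH"[where p = "p + 3" and q = "q + 3"])
            (use "1.prems" True ij ji in \<open>auto simp: r1_def add.assoc\<close>)
        then obtain T r' where T: "T \<le> 7 * length xs + 3"
          "(step k query_program ^^ T) \<lparr>pc = 14, reg = r1, mem = m\<rparr> = \<lparr>pc = 27, reg = r', mem = m\<rparr>"
          "r' 8 = decode xs ys" "r' 2 = r1 2" "r' 3 = r1 3" "r' 7 = r1 7" "r' 9 = 0"
          by blast
        show ?thesis
          by (intro exI[of _ "7 + T"] conjI exI[of _ r'])
            (use T True ij ji funpow_trans[OF s1 T(2)] in \<open>auto simp: r1_def\<close>)
      qed
    qed
  qed
qed auto

text \<open>Cell \<open>0\<close> stands for infinity: decrementing it modulo \<open>2 ^ k\<close> gives the largest word.\<close>

definition decrement_word :: "nat \<Rightarrow> nat \<Rightarrow> nat" where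
  "decrement_word k u = take_bit k (u + 2 ^ k - 1)"

lemma decrement_word_Suc: "u < 2 ^ k \<Longrightarrow> decrement_word k (Suc u) = u"
  by (simp add: decrement_word_def take_bit_eq_mod)

lemma decrement_word_0: "decrement_word k 0 = 2 ^ k - 1"
  by (simp add: decrement_word_def take_bit_nat_eq_self)

text \<open>The straight-line parts cost \<open>6 + 4 + 2 + 1\<close> steps and the three minima at
  most \<open>2\<close> each; with the \<open>3\<close> of the loop this is \<open>22\<close>. The
  last three premises exclude overflow and wrap-around.\<close>

lemma query_program_run:
  assumes "r 0 = q" "r 4 = 0" "r 9 = 0"
    and "m 0 = f" "m 1 = h" "m (q + 2) = g"
    and "entries_at m 3 xs" "entries_at m (q + 3) ys" "terminated xs" "terminated ys"
    and "3 * length xs + 3 < 2 ^ k" "q + 3 * length ys + 3 < 2 ^ k"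
    and "f + r 2 < 2 ^ k" "decode xs ys + r 2 < 2 ^ k" "r 3 \<le> decode xs ys + r 2"
  shows "\<exists>T\<le>7 * length xs + 22. outputs k query_program \<lparr>pc = 0, reg = r, mem = m\<rparr> T
           (min (min (min (f + r 2) (decrement_word k h)) (decrement_word k g))
             (decode xs ys + r 2 - r 3))"
proof -
  have "0 < length ys" using assms(10) by (cases ys) auto
  then have k3: "q + 3 < 2 ^ k" "(3::nat) < 2 ^ k" using assms(12) by linarith+
  then have tb: "take_bit k x = x" if "x \<le> q + 2 \<or> x \<le> 3" for x
    using that by (intro take_bit_nat_eq_self) linarith
  have [simp]: "0 < k" using k3(2) by (cases k) auto
  have [simp]: "take_bit k (Suc q) = Suc q" "take_bit k (Suc (Suc q)) = q + 2"
    "take_bit k 3 = (3::nat)"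
    using tb[of "Suc q"] tb[of "q + 2"] tb[of 3] by simp_all
  have dw: "decrement_word k u < 2 ^ k" for u by (simp add: decrement_word_def take_bit_nat_less_exp)
  have f: "take_bit k (f + r 2) = f + r 2" using assms(13) by (rule take_bit_nat_eq_self)
  define r1 where "r1 = r(5 := 1, 6 := 3, 7 := f + r 2, 8 := decrement_word k h)"
  have s1: "(step k query_program ^^ 6) \<lparr>pc = 0, reg = r, mem = m\<rparr> = \<lparr>pc = 6, reg = r1, mem = m\<rparr>"
    using assms(1-6) by (auto simp: run_simps f r1_def decrement_word_def fun_eq_iff)
  define M1 where "M1 = min (f + r 2) (decrement_word k h)"
  obtain T1 where T1: "T1 \<le> 2" "(step k query_program ^^ T1) \<lparr>pc = 6, reg = r1, mem = m\<rparr> =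
       \<lparr>pc = 8, reg = r1(7 := M1), mem = m\<rparr>"
    using min_assign_run[of r1 k 6 m] assms(3,13) dw
    by (auto simp: r1_def M1_def query_program_nth)
  define r2 where "r2 = r1(7 := M1, 8 := decrement_word k g)"
  have s2: "(step k query_program ^^ 4) \<lparr>pc = 8, reg = r1(7 := M1), mem = m\<rparr> =
      \<lparr>pc = 12, reg = r2, mem = m\<rparr>"
    using assms(1-6) by (auto simp: run_simps r1_def r2_def decrement_word_def fun_eq_iff)
  define M2 where "M2 = min M1 (decrement_word k g)"
  have M1: "M1 < 2 ^ k" using assms(13) by (simp add: M1_def)
  obtain T2 where T2: "T2 \<le> 2" "(step k query_program ^^ T2) \<lparr>pc = 12, reg = r2, mem = m\<rparr> =
       \<lparr>pc = 14, reg = r2(7 := M2), mem = m\<rparr>"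
    using min_assign_run[of r2 k 12 m] assms(3) dw M1
    by (auto simp: r1_def r2_def M2_def query_program_nth)
  have "\<exists>T\<le>7 * length xs + 3. \<exists>r'. (step k query_program ^^ T) \<lparr>pc = 14, reg = r2(7 := M2), mem = m\<rparr> =
           \<lparr>pc = 27, reg = r', mem = m\<rparr> \<and> r' 8 = decode xs ys \<and>
           r' 2 = (r2(7 := M2)) 2 \<and> r' 3 = (r2(7 := M2)) 3 \<and> r' 7 = (r2(7 := M2)) 7 \<and> r' 9 = 0"
    by (rule loop_run[where p = 0 and q = q]) (use assms in \<open>auto simp: r1_def r2_def\<close>)
  then obtain T3 r3 where T3: "T3 \<le> 7 * length xs + 3"
    "(step k query_program ^^ T3) \<lparr>pc = 14, reg = r2(7 := M2), mem = m\<rparr> = \<lparr>pc = 27, reg = r3, mem = m\<rparr>"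
    and r3: "r3 8 = decode xs ys" "r3 2 = r 2" "r3 3 = r 3" "r3 7 = M2" "r3 9 = 0"
    by (auto simp: r1_def r2_def)
  define D where "D = decode xs ys + r 2 - r 3"
  have D: "D < 2 ^ k" using assms(14) by (simp add: D_def)
  \<comment> \<open>\<open>Sub\<close> adds \<open>2 ^ k\<close> first; as the true difference is
    not negative, truncation removes exactly this summand.\<close>
  have "decode xs ys + r 2 + 2 ^ k - r 3 = D + 2 ^ k" using assms(15) by (simp add: D_def)
  then have tD: "take_bit k (decode xs ys + r 2 + 2 ^ k - r 3) = D"
    using D by (simp add: take_bit_eq_mod)
  have s3: "(step k query_program ^^ 2) \<lparr>pc = 27, reg = r3, mem = m\<rparr> =
      \<lparr>pc = 29, reg = r3(8 := D), mem = m\<rparr>"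
    using r3 assms(14) tD by (simp add: run_simps take_bit_nat_eq_self)
  define M3 where "M3 = min M2 D"
  have M2: "M2 < 2 ^ k" using M1 by (simp add: M2_def)
  obtain T4 where T4: "T4 \<le> 2" "(step k query_program ^^ T4) \<lparr>pc = 29, reg = r3(8 := D), mem = m\<rparr> =
       \<lparr>pc = 31, reg = r3(8 := D, 7 := M3), mem = m\<rparr>"
    using min_assign_run[of "r3(8 := D)" k 29 m] r3 M2 D
    by (auto simp: M3_def query_program_nth)
  have M3: "M3 < 2 ^ k" using M2 by (simp add: M3_def)
  have s4: "(step k query_program ^^ 1) \<lparr>pc = 31, reg = r3(8 := D, 7 := M3), mem = m\<rparr> =
      \<lparr>pc = 32, reg = r3(8 := D, 7 := M3, 0 := M3), mem = m\<rparr>"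
    using M3 r3 by (simp add: run_simps take_bit_nat_eq_self)
  have "(step k query_program ^^ (6 + (T1 + (4 + (T2 + (T3 + (2 + (T4 + 1))))))))
      \<lparr>pc = 0, reg = r, mem = m\<rparr> = \<lparr>pc = 32, reg = r3(8 := D, 7 := M3, 0 := M3), mem = m\<rparr>"
    by (intro funpow_trans[OF s1] funpow_trans[OF T1(2)] funpow_trans[OF s2] funpow_trans[OF T2(2)]
      funpow_trans[OF T3(2)] funpow_trans[OF s3] funpow_trans[OF T4(2)] s4)
  then have "outputs k query_program \<lparr>pc = 0, reg = r, mem = m\<rparr>
      (6 + (T1 + (4 + (T2 + (T3 + (2 + (T4 + 1))))))) M3"
    unfolding outputs_def by (simp only: Let_def length_query_program) simp
  then show ?thesis
    using T1(1) T2(1) T3(1) T4(1) unfolding M3_def M2_def M1_def D_def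
    by (intro exI[of _ "6 + (T1 + (4 + (T2 + (T3 + (2 + (T4 + 1))))))"]) simp
qed


section \<open>Bit strings\<close>

lemma less_power_floorlog: "m < 2 ^ floorlog 2 m"
  using floorlog_bounds[of m 2] by (cases "m = 0") auto

lemma real_floorlog_le: "0 < m \<Longrightarrow> real (floorlog 2 m) \<le> log 2 m + 1"
  by (simp add: floorlog_def)

definition encode_cells :: "nat \<Rightarrow> nat list \<Rightarrow> bool list" where
  "encode_cells b zs = concat (map (\<lambda>z. map (bit z) [0..<b]) zs)"

lemma length_encode_cells: "length (encode_cells b zs) = b * length zs"
  by (induction zs) (simp_all add: encode_cells_def)

lemma take_drop_encode_cells:
  "i < length zs \<Longrightarrow> take b (drop (i * b) (encode_cells b zs)) = map (bit (zs ! i)) [0..<b]"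
proof (induction zs arbitrary: i)
  case (Cons z zs)
  show ?case
  proof (cases i)
    case 0
    then show ?thesis by (simp add: encode_cells_def)
  next
    case (Suc j)
    have "drop (i * b) (encode_cells b (z # zs)) = drop (j * b) (encode_cells b zs)"
      by (simp add: Suc encode_cells_def)
    then show ?thesis using Cons Suc by simp
  qed
qed simp

text \<open>Each cell takes exactly \<open>b\<close> bits, so the blocks of \<open>pack\<close> are
  the binary expansions of the cells.\<close>

lemma pack_encode_cells:
  assumes "0 < b" "\<forall>z \<in> set zs. z < 2 ^ b"
  shows "pack b (encode_cells b zs) = zs"
proof -
  have "(length (encode_cells b zs) + b - 1) div b = (b - 1 + length zs * b) div b"
    using assms(1) by (simp add: length_encode_cells algebra_simps)
  also have "\<dots> = length zs" using assms(1) by (subst div_mult_self1) auto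
  finally have len: "(length (encode_cells b zs) + b - 1) div b = length zs" .
  show ?thesis unfolding pack_def len
  proof (rule nth_equalityI)
    fix i assume "i < length (map (\<lambda>i. horner_sum of_bool 2 (take b (drop (i * b) (encode_cells b zs)))) [0..<length zs] :: nat list)"
    then have i: "i < length zs" by simp
    have "take_bit b (zs ! i) = zs ! i"
      using assms(2) i by (intro take_bit_nat_eq_self) auto
    then show "map (\<lambda>i. horner_sum of_bool 2 (take b (drop (i * b) (encode_cells b zs)))) [0..<length zs] ! i = zs ! i"
      using i by (simp add: take_drop_encode_cells horner_sum_bit_eq_take_bit)
  qed simp
qed


section \<open>Locating the first separating cut\<close>

lemma find_sorted:
  assumes "sorted (map f xs)" "x \<in> set xs" "P x"
  shows "\<exists>y. find P xs = Some y \<and> y \<in> set xs \<and> P y \<and> f y \<le> f x"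
  using assms by (induction xs) auto

text \<open>\<open>B\<close> is the block of vertices not yet separated from \<open>v\<close>, and
  \<open>A\<close> a part with at most half of it. A vertex in \<open>C\<close> can only be the tail
  of an arc leaving \<open>C\<close>, a vertex outside only the head; the other position gets the
  default \<open>z\<close>.\<close>

fun entries :: "('a set \<Rightarrow> nat) \<Rightarrow> nat \<Rightarrow> 'a set list \<Rightarrow> 'a set \<Rightarrow> 'a \<Rightarrow> entry list" where
  "entries f z [] B v = [(0, z, z)]"
| "entries f z (C # Cs) B v =
     (let A = (if 2 * card (B \<inter> C) \<le> card B then B \<inter> C else B - C)
      in if v \<in> A
         then (Suc (length Cs), if v \<in> C then f C else z, if v \<in> C then z else f C) #
                entries f z Cs A v
         else entries f z Cs (B - A) v)"

lemma terminated_entries: "terminated (entries f z Cs B v)"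
  by (induction Cs arbitrary: B) (auto simp: Let_def)

lemma entries_neq_Nil: "entries f z Cs B v \<noteq> []"
  using terminated_entries[of f z Cs B v] by auto

lemma fst_hd_entries: "fst (hd (entries f z Cs B v)) \<le> length Cs"
  by (induction Cs arbitrary: B) (auto simp: Let_def le_SucI)

lemma entries_mem:
  assumes "(i, a, b) \<in> set (entries f z Cs B v)"
  shows "i \<le> length Cs \<and> a \<in> insert z (f ` set Cs) \<and> b \<in> insert z (f ` set Cs)"
  using assms
  by (induction Cs arbitrary: B) (fastforce simp: Let_def split: if_splits)+

text \<open>Each recorded cut at least halves the block of \<open>v\<close>, which stays nonempty;
  the closing entry accounts for the factor \<open>2\<close>.\<close>

lemma length_entries:
  assumes "finite B" "v \<in> B"
  shows "2 ^ length (entries f z Cs B v) \<le> 2 * card B"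
  using assms
proof (induction Cs arbitrary: B)
  case Nil
  then have "card B \<noteq> 0" by auto
  then have "1 \<le> card B" by linarith
  then show ?case by simp
next
  case (Cons C Cs)
  define A where "A = (if 2 * card (B \<inter> C) \<le> card B then B \<inter> C else B - C)"
  have A: "A \<subseteq> B" "2 * card A \<le> card B"
    using card_Diff_subset_Int[of B C] Cons.prems(1) by (auto simp: A_def)
  show ?case
  proof (cases "v \<in> A")
    case True
    have "2 ^ length (entries f z Cs A v) \<le> 2 * card A"
      using Cons True A finite_subset by metis
    then show ?thesis using True A by (simp add: A_def[symmetric] Let_def)
  next
    case False
    have "2 ^ length (entries f z Cs (B - A) v) \<le> 2 * card (B - A)"
      using Cons False by simp
    also have "\<dots> \<le> 2 * card B" using Cons.prems(1) by (simp add: card_mono)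
    finally show ?thesis using False by (simp add: A_def[symmetric] Let_def)
  qed
qed

text \<open>Up to the first separating cut, both vertices share a block and record the same indices.
  At that cut exactly one of them records, and the next index of the other is lower, so the
  comparison selects the new entry.\<close>

lemma decode_entries:
  assumes "x \<in> B" "y \<in> B"
  shows "decode (entries f z Cs B x) (entries f z Cs B y) =
     (case find (\<lambda>C. (x \<in> C) \<noteq> (y \<in> C)) Cs of None \<Rightarrow> z | Some C \<Rightarrow> if x \<in> C then f C else z)"
  using assms
proof (induction Cs arbitrary: B)
  case (Cons C Cs)
  define A where "A = (if 2 * card (B \<inter> C) \<le> card B then B \<inter> C else B - C)"
  have sides: "(x \<in> A) = (y \<in> A) \<longleftrightarrow> (x \<in> C) = (y \<in> C)"
    using Cons.prems by (auto simp: A_def)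
  have hd: "\<exists>j a b ys. entries f z Cs (B - A) v = (j, a, b) # ys \<and> j < Suc (length Cs)" for v
    using fst_hd_entries[of f z Cs "B - A" v] entries_neq_Nil[of f z Cs "B - A" v]
    by (cases "entries f z Cs (B - A) v") (auto simp: less_Suc_eq_le)
  have IH: "decode (entries f z Cs B' x) (entries f z Cs B' y) =
     (case find (\<lambda>C. (x \<in> C) \<noteq> (y \<in> C)) Cs of None \<Rightarrow> z | Some C \<Rightarrow> if x \<in> C then f C else z)"
    if "x \<in> B'" "y \<in> B'" for B'
    using Cons.IH that .
  consider "x \<in> A" "y \<in> A" | "x \<in> A" "y \<notin> A" | "x \<notin> A" "y \<in> A" | "x \<notin> A" "y \<notin> A"
    by blast
  then show ?case
  proof cases
    case 1
    then show ?thesis using sides IH[of A] by (simp add: A_def[symmetric] Let_def)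
  next
    case 2
    with hd[of y] show ?thesis using sides by (auto simp: A_def[symmetric] Let_def)
  next
    case 3
    with hd[of x] show ?thesis using sides by (auto simp: A_def[symmetric] Let_def)
  next
    case 4
    then show ?thesis using sides IH[of "B - A"] Cons.prems
      by (simp add: A_def[symmetric] Let_def)
  qed
qed simp

lemma entries_at_nth:
  assumes "\<And>i. i < 3 * length xs \<Longrightarrow> m (p + i) = concat (map entry_cells xs) ! i"
  shows "entries_at m p xs"
  using assms
proof (induction xs arbitrary: p)
  case (Cons x xs)
  obtain i a b where x: "x = (i, a, b)" by (cases x)
  have "entries_at m (p + 3) xs"
  proof (rule Cons.IH)
    fix j assume "j < 3 * length xs"
    then show "m (p + 3 + j) = concat (map entry_cells xs) ! j"
      using Cons.prems[of "3 + j"] by (simp add: x add.assoc)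
  qed
  then show ?case using Cons.prems[of 0] Cons.prems[of 1] Cons.prems[of 2] by (simp add: x)
qed simp

lemma length_concat_entry_cells: "length (concat (map entry_cells xs)) = 3 * length xs"
  by (induction xs) auto


section \<open>Vital arcs\<close>

locale st_network =
  fixes G :: "'a pair_pre_digraph" and w :: "'a \<times> 'a \<Rightarrow> nat" and s t :: 'a
  assumes fin: "pair_fin_digraph G"
    and s: "s \<in> pverts G" and t: "t \<in> pverts G" and st: "s \<noteq> t"
begin

section \<open>Cuts of a fixed network and submodularity\<close>

abbreviation "is_cut \<equiv> st_cut G s t"
abbreviation "cap \<equiv> cut_capacity G w"
abbreviation "mincut \<equiv> mincut_capacity G w s t"

definition max_capacity :: nat where
  "max_capacity = Max (w ` parcs G)"

lemma finite_verts: "finite (pverts G)" and finite_arcs: "finite (parcs G)"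
  using fin by (auto simp: pair_fin_digraph_def pair_fin_digraph_axioms_def)

lemma arc_verts: "(x, y) \<in> parcs G \<Longrightarrow> x \<in> pverts G \<and> y \<in> pverts G"
  using fin by (auto simp: pair_fin_digraph_def pair_wf_digraph_def)

lemma finite_cuts: "finite {C. is_cut C}"
  by (rule finite_subset[of _ "Pow (pverts G)"]) (auto simp: st_cut_def finite_verts)

lemma cut_source: "is_cut {s}"
  using s st by (simp add: st_cut_def)

lemma mincut_le: "is_cut C \<Longrightarrow> mincut_capacity G w' s t \<le> cut_capacity G w' C"
  unfolding mincut_capacity_def using finite_cuts by (intro Min_le) auto

lemma mincut_attained: "\<exists>C. is_cut C \<and> cut_capacity G w' C = mincut_capacity G w' s t"
proof -
  have "mincut_capacity G w' s t \<in> cut_capacity G w' ` {C. is_cut C}"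
    unfolding mincut_capacity_def using finite_cuts cut_source by (intro Min_in) auto
  then show ?thesis by auto
qed

text \<open>With a common index set, capacities of different cuts can be compared arc by
  arc.\<close>

lemma cut_capacity_alt:
  "C \<subseteq> pverts G \<Longrightarrow>
     cut_capacity G w' C = (\<Sum>e\<in>parcs G. w' e * of_bool (fst e \<in> C \<and> snd e \<notin> C))"
  unfolding cut_capacity_def
  by (rule sum.mono_neutral_cong_left) (use finite_arcs arc_verts in auto)

lemma arc_le_cap: "(x, y) \<in> parcs G \<Longrightarrow> x \<in> C \<Longrightarrow> y \<notin> C \<Longrightarrow> w (x, y) \<le> cap C"
  unfolding cut_capacity_def
  by (rule member_le_sum) (use finite_arcs arc_verts in auto)

lemma cap_change:
  assumes "(x, y) \<in> parcs G" "- int (w (x, y)) \<le> \<Delta>" "C \<subseteq> pverts G"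
  shows "int (cut_capacity G (change_capacity w (x, y) \<Delta>) C) =
           int (cap C) + (if x \<in> C \<and> y \<notin> C then \<Delta> else 0)"
proof -
  have split: "int (cut_capacity G w' C) = int (w' (x, y)) * of_bool (x \<in> C \<and> y \<notin> C) +
      (\<Sum>e\<in>parcs G - {(x, y)}. int (w' e) * of_bool (fst e \<in> C \<and> snd e \<notin> C))" for w'
    unfolding cut_capacity_alt[OF assms(3)] of_nat_sum of_nat_mult of_nat_of_bool
    by (subst sum.remove[OF finite_arcs assms(1)]) (simp only: fst_conv snd_conv)
  have "(\<Sum>e\<in>parcs G - {(x, y)}. int (change_capacity w (x, y) \<Delta> e) * of_bool (fst e \<in> C \<and> snd e \<notin> C)) =
      (\<Sum>e\<in>parcs G - {(x, y)}. int (w e) * of_bool (fst e \<in> C \<and> snd e \<notin> C))"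
    by (rule sum.cong) (auto simp: change_capacity_def)
  then show ?thesis
    unfolding split using assms(2) by (auto simp: change_capacity_def)
qed

text \<open>An arc between \<open>C - D\<close> and \<open>D - C\<close>, in either direction,
  leaves exactly one of \<open>C\<close> and \<open>D\<close> but neither their intersection nor
  their union. This gives the slack \<open>sum w S\<close>.\<close>

lemma cap_submodular:
  assumes "C \<subseteq> pverts G" "D \<subseteq> pverts G" "S \<subseteq> parcs G"
    and "\<And>e. e \<in> S \<Longrightarrow> fst e \<in> C - D \<and> snd e \<in> D - C \<or> fst e \<in> D - C \<and> snd e \<in> C - D"
  shows "cap (C \<inter> D) + cap (C \<union> D) + sum w S \<le> cap C + cap D"
proof -
  have "sum w S = (\<Sum>e\<in>parcs G. w e * of_bool (e \<in> S))"
    using assms(3) finite_arcs by (intro sum.mono_neutral_cong_left) auto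
  moreover have "C \<inter> D \<subseteq> pverts G" "C \<union> D \<subseteq> pverts G" using assms(1,2) by auto
  ultimately have "cap (C \<inter> D) + cap (C \<union> D) + sum w S =
     (\<Sum>e\<in>parcs G. w e * (of_bool (fst e \<in> C \<inter> D \<and> snd e \<notin> C \<inter> D) +
        of_bool (fst e \<in> C \<union> D \<and> snd e \<notin> C \<union> D) + of_bool (e \<in> S)))"
    using assms(1,2) by (simp only: cut_capacity_alt sum.distrib distrib_left)
  also have "\<dots> \<le> (\<Sum>e\<in>parcs G. w e * (of_bool (fst e \<in> C \<and> snd e \<notin> C) + of_bool (fst e \<in> D \<and> snd e \<notin> D)))"
    using assms(4) by (intro sum_mono mult_le_mono2) (auto simp: of_bool_def)
  also have "\<dots> = cap C + cap D"
    using assms(1,2) by (simp only: cut_capacity_alt sum.distrib distrib_left)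
  finally show ?thesis .
qed

section \<open>Optimal cuts of vital arcs\<close>

definition arc_cut :: "'a \<times> 'a \<Rightarrow> 'a set \<Rightarrow> bool" where
  "arc_cut e C \<longleftrightarrow> is_cut C \<and> fst e \<in> C \<and> snd e \<notin> C"

definition min_arc_cut :: "'a \<times> 'a \<Rightarrow> 'a set \<Rightarrow> bool" where
  "min_arc_cut e C \<longleftrightarrow> arc_cut e C \<and> (\<forall>D. arc_cut e D \<longrightarrow> cap C \<le> cap D)"

text \<open>These are the arcs whose deletion lowers the mincut capacity.\<close>

definition vital :: "'a \<times> 'a \<Rightarrow> bool" where
  "vital e \<longleftrightarrow> e \<in> parcs G \<and> (\<exists>C. arc_cut e C \<and> cap C < mincut + w e)"

lemma vital_min_arc_cut:
  assumes "vital e"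
  shows "\<exists>C. min_arc_cut e C \<and> cap C < mincut + w e"
proof -
  obtain C0 where C0: "arc_cut e C0" "cap C0 < mincut + w e"
    using assms by (auto simp: vital_def)
  define C where "C = arg_min cap (arc_cut e)"
  have "arc_cut e C" "\<And>D. arc_cut e D \<Longrightarrow> cap C \<le> cap D"
    unfolding C_def using arg_min_nat_lemma[of "arc_cut e" C0 cap] C0(1) by blast+
  then show ?thesis using C0 unfolding min_arc_cut_def by (metis le_less_trans)
qed

text \<open>Otherwise \<open>C\<close> can be uncrossed with an optimal cut \<open>D\<close> of
  \<open>(u, v)\<close>: this arc runs from \<open>D - C\<close> to \<open>C - D\<close> and
  contributes slack.\<close>

lemma min_arc_cut_not_reversed:
  assumes C: "min_arc_cut e C" "cap C < mincut + w e" "e \<in> parcs G"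
    and e': "vital (u, v)" and "v \<in> C"
  shows "u \<in> C"
proof (rule ccontr)
  assume u: "u \<notin> C"
  obtain x y where e: "e = (x, y)" by (cases e)
  obtain D where D: "min_arc_cut (u, v) D" "cap D < mincut + w (u, v)"
    using vital_min_arc_cut[OF e'] by blast
  have arc': "(u, v) \<in> parcs G" using e' by (simp add: vital_def)
  have cuts: "is_cut C" "is_cut D" "x \<in> C" "y \<notin> C" "u \<in> D" "v \<notin> D"
    using C D by (auto simp: min_arc_cut_def arc_cut_def e)
  then have subs: "C \<subseteq> pverts G" "D \<subseteq> pverts G" by (auto simp: st_cut_def)
  have IU: "is_cut (C \<inter> D)" "is_cut (C \<union> D)" using cuts by (auto simp: st_cut_def)
  note le = IU[THEN mincut_le, of w]
  show False
  proof (cases "x \<notin> D \<and> y \<in> D")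
    case True
    \<comment> \<open>Both arcs contribute slack, while intersection and union cost at least
      \<open>mincut\<close> each. This contradicts the sum of the two strict bounds.\<close>
    have "cap (C \<inter> D) + cap (C \<union> D) + sum w {(x, y), (u, v)} \<le> cap C + cap D"
      by (rule cap_submodular[OF subs]) (use True cuts u assms(5) C(3) arc' e in auto)
    moreover have "(x, y) \<noteq> (u, v)" using cuts u by auto
    ultimately show False using le C(2) D(2) by (simp add: e)
  next
    case False
    \<comment> \<open>The intersection if \<open>x \<in> D\<close>, the union if
      \<open>y \<notin> D\<close>. By optimality that cut costs at least \<open>cap C\<close>, the
      other at least \<open>mincut\<close>, which leaves
      \<open>mincut + w (u, v) \<le> cap D\<close>.\<close>
    then have "arc_cut (x, y) (C \<inter> D) \<or> arc_cut (x, y) (C \<union> D)"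
      using cuts IU by (auto simp: arc_cut_def)
    then have "cap C \<le> cap (C \<inter> D) \<or> cap C \<le> cap (C \<union> D)"
      using C(1) by (auto simp: min_arc_cut_def e)
    moreover have "cap (C \<inter> D) + cap (C \<union> D) + sum w {(u, v)} \<le> cap C + cap D"
      by (rule cap_submodular[OF subs]) (use cuts u assms(5) arc' in auto)
    ultimately show False using le D(2) by auto
  qed
qed

text \<open>One optimal cut is chosen per vital arc. The bound on the length keeps the indices in
  the labels small.\<close>

lemma vital_cuts_exist:
  "\<exists>Cs. length Cs \<le> card (parcs G) \<and> sorted (map cap Cs) \<and> (\<forall>C\<in>set Cs. is_cut C) \<and>
     (\<forall>e. vital e \<longrightarrow> (\<exists>C\<in>set Cs. min_arc_cut e C)) \<and>
     (\<forall>C\<in>set Cs. \<forall>u v. vital (u, v) \<longrightarrow> v \<in> C \<longrightarrow> u \<in> C)"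
proof -
  obtain f where f: "\<And>e. vital e \<Longrightarrow> min_arc_cut e (f e) \<and> cap (f e) < mincut + w e"
    using vital_min_arc_cut by metis
  have V: "{e. vital e} \<subseteq> parcs G" by (auto simp: vital_def)
  then have fin: "finite {e. vital e}" using finite_arcs finite_subset by blast
  obtain Ds where Ds: "set Ds = f ` {e. vital e}" "distinct Ds"
    using finite_distinct_list[of "f ` {e. vital e}"] fin by auto
  have "length Ds \<le> card {e. vital e}"
    using Ds distinct_card[of Ds] card_image_le[OF fin, of f] by simp
  also have "\<dots> \<le> card (parcs G)" using V finite_arcs by (rule card_mono[rotated])
  finally have "length (sort_key cap Ds) \<le> card (parcs G)" by simp
  moreover have "\<forall>C\<in>set (sort_key cap Ds). is_cut C"
    using f by (auto simp: Ds min_arc_cut_def arc_cut_def)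
  moreover have "\<forall>e. vital e \<longrightarrow> (\<exists>C\<in>set (sort_key cap Ds). min_arc_cut e C)"
    using f by (auto simp: Ds)
  moreover have "\<forall>C\<in>set (sort_key cap Ds). \<forall>u v. vital (u, v) \<longrightarrow> v \<in> C \<longrightarrow> u \<in> C"
    using f min_arc_cut_not_reversed by (fastforce simp: Ds vital_def)
  ultimately show ?thesis
    by (intro exI[of _ "sort_key cap Ds"]) simp
qed

section \<open>Labels from the cuts of vital arcs\<close>

definition vital_cuts :: "'a set list" where
  "vital_cuts = (SOME Cs. length Cs \<le> card (parcs G) \<and> sorted (map cap Cs) \<and> (\<forall>C\<in>set Cs. is_cut C) \<and>
     (\<forall>e. vital e \<longrightarrow> (\<exists>C\<in>set Cs. min_arc_cut e C)) \<and>
     (\<forall>C\<in>set Cs. \<forall>u v. vital (u, v) \<longrightarrow> v \<in> C \<longrightarrow> u \<in> C))"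

lemma vital_cuts:
  "length vital_cuts \<le> card (parcs G)" "sorted (map cap vital_cuts)"
  "\<And>C. C \<in> set vital_cuts \<Longrightarrow> is_cut C"
  "\<And>e. vital e \<Longrightarrow> \<exists>C\<in>set vital_cuts. min_arc_cut e C"
  "\<And>C u v. C \<in> set vital_cuts \<Longrightarrow> vital (u, v) \<Longrightarrow> v \<in> C \<Longrightarrow> u \<in> C"
  using someI_ex[OF vital_cuts_exist] unfolding vital_cuts_def[symmetric] by blast+

text \<open>The default \<open>mincut + max_capacity\<close> is still at least \<open>mincut\<close> after any admissible decrease.\<close>

definition vertex_entries :: "'a \<Rightarrow> entry list" where
  "vertex_entries = entries cap (mincut + max_capacity) vital_cuts (pverts G)"

text \<open>For an arc that is not vital the value need not be optimal, but it belongs to a cut that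
  the arc crosses or is the default, so it cannot push the result below the new mincut.\<close>

lemma decode_vertex_entries:
  assumes "x \<in> pverts G" "y \<in> pverts G"
  shows "decode (vertex_entries x) (vertex_entries y) = mincut + max_capacity \<or>
    (\<exists>C. arc_cut (x, y) C \<and> cap C = decode (vertex_entries x) (vertex_entries y))"
proof (cases "find (\<lambda>C. (x \<in> C) \<noteq> (y \<in> C)) vital_cuts")
  case None
  then show ?thesis using assms by (simp add: vertex_entries_def decode_entries)
next
  case (Some C)
  then have "C \<in> set vital_cuts" "(x \<in> C) \<noteq> (y \<in> C)"
    by (auto simp: find_Some_iff)
  then show ?thesis using assms Some vital_cuts(3)
    by (auto simp: vertex_entries_def decode_entries arc_cut_def)
qed

text \<open>The list contains an optimal cut of the arc, so the first separating cut costs no more;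
  a vital arc cannot cross it backwards.\<close>

lemma decode_vertex_entries_vital:
  assumes "vital (x, y)" "arc_cut (x, y) D"
  shows "decode (vertex_entries x) (vertex_entries y) \<le> cap D"
proof -
  have xy: "x \<in> pverts G" "y \<in> pverts G" using assms(1) arc_verts by (auto simp: vital_def)
  obtain C where C: "C \<in> set vital_cuts" "min_arc_cut (x, y) C"
    using vital_cuts(4)[OF assms(1)] by blast
  then have "(x \<in> C) \<noteq> (y \<in> C)" by (auto simp: min_arc_cut_def arc_cut_def)
  from find_sorted[where P = "\<lambda>C. (x \<in> C) \<noteq> (y \<in> C)", OF vital_cuts(2) C(1) this]
  obtain C' where C': "find (\<lambda>C. (x \<in> C) \<noteq> (y \<in> C)) vital_cuts = Some C'" "C' \<in> set vital_cuts"
      "(x \<in> C') \<noteq> (y \<in> C')" "cap C' \<le> cap C"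
    by blast
  then have "x \<in> C'" using vital_cuts(5)[OF C'(2) assms(1)] by auto
  then show ?thesis using C' C(2) assms(2) xy
    by (auto simp: vertex_entries_def decode_entries min_arc_cut_def)
qed

text \<open>Both are offset by \<open>1\<close>, and \<open>0\<close> means that there is no such cut
  (\<open>v = s\<close> or \<open>v = t\<close>, respectively).\<close>

definition avoiding :: "'a \<Rightarrow> nat" where
  "avoiding v = (if v = s then 0 else Suc (Min (cap ` {C. is_cut C \<and> v \<notin> C})))"

definition containing :: "'a \<Rightarrow> nat" where
  "containing v = (if v = t then 0 else Suc (Min (cap ` {C. is_cut C \<and> v \<in> C})))"

lemma avoiding_cases:
  obtains (none) "avoiding v = 0" "\<And>C. is_cut C \<Longrightarrow> v \<in> C"
  | (some) C where "is_cut C" "v \<notin> C" "avoiding v = Suc (cap C)" "\<And>D. is_cut D \<Longrightarrow> v \<notin> D \<Longrightarrow> cap C \<le> cap D"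
proof (cases "v = s")
  case True
  then show ?thesis using none by (simp add: avoiding_def st_cut_def)
next
  case False
  have fin: "finite {C. is_cut C \<and> v \<notin> C}" using finite_cuts by (rule finite_subset[rotated]) auto
  have "Min (cap ` {C. is_cut C \<and> v \<notin> C}) \<in> cap ` {C. is_cut C \<and> v \<notin> C}"
    using fin cut_source False by (intro Min_in) auto
  then obtain C where C: "is_cut C" "v \<notin> C" "cap C = Min (cap ` {C. is_cut C \<and> v \<notin> C})" by auto
  show ?thesis
    using C fin False by (intro some[of C]) (auto simp: avoiding_def)
qed

lemma containing_cases:
  assumes "v \<in> pverts G"
  obtains (none) "containing v = 0" "\<And>C. is_cut C \<Longrightarrow> v \<notin> C"
  | (some) C where "is_cut C" "v \<in> C" "containing v = Suc (cap C)" "\<And>D. is_cut D \<Longrightarrow> v \<in> D \<Longrightarrow> cap C \<le> cap D"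
proof (cases "v = t")
  case True
  then show ?thesis using none by (simp add: containing_def st_cut_def)
next
  case False
  have fin: "finite {C. is_cut C \<and> v \<in> C}" using finite_cuts by (rule finite_subset[rotated]) auto
  have "is_cut {s, v}" using False assms s st by (auto simp: st_cut_def)
  then have "Min (cap ` {C. is_cut C \<and> v \<in> C}) \<in> cap ` {C. is_cut C \<and> v \<in> C}"
    using fin by (intro Min_in) auto
  then obtain C where C: "is_cut C" "v \<in> C" "cap C = Min (cap ` {C. is_cut C \<and> v \<in> C})" by auto
  show ?thesis
    using C fin False by (intro some[of C]) (auto simp: containing_def)
qed

section \<open>The mincut after a change\<close>

lemma arc_le_max_capacity: "e \<in> parcs G \<Longrightarrow> w e \<le> max_capacity"
  unfolding max_capacity_def using finite_arcs by (intro Min_le Max_ge) auto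

text \<open>Ensures that subtracting the negative part of an admissible \<open>\<Delta>\<close>
  truncates nothing.\<close>

lemma decode_ge:
  assumes "(x, y) \<in> parcs G"
  shows "w (x, y) \<le> decode (vertex_entries x) (vertex_entries y)"
  using decode_vertex_entries[of x y] assms arc_verts[OF assms] arc_le_max_capacity[OF assms]
    arc_le_cap[OF assms] by (force simp: arc_cut_def)

lemma mincut_change:
  assumes arc: "(x, y) \<in> parcs G" and \<Delta>: "- int (w (x, y)) \<le> \<Delta>"
    and k: "mincut + nat \<Delta> < 2 ^ k" "avoiding x < 2 ^ k" "containing y < 2 ^ k"
  shows "min (min (min (mincut + nat \<Delta>) (decrement_word k (avoiding x)))
             (decrement_word k (containing y)))
           (decode (vertex_entries x) (vertex_entries y) + nat \<Delta> - nat (- \<Delta>)) =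
         mincut_capacity G (change_capacity w (x, y) \<Delta>) s t"
    (is "min (min (min ?f ?h) ?g) ?m = ?M")
proof (rule antisym)
  have xy: "x \<in> pverts G" "y \<in> pverts G" using arc_verts[OF arc] by auto
  have m: "int ?m = int (decode (vertex_entries x) (vertex_entries y)) + \<Delta>"
    using decode_ge[OF arc] \<Delta> by simp
  let ?cap' = "cut_capacity G (change_capacity w (x, y) \<Delta>)"
  have cap': "int (?cap' C) = int (cap C) + (if x \<in> C \<and> y \<notin> C then \<Delta> else 0)" if "is_cut C" for C
    using cap_change[OF arc \<Delta>, of C] that by (simp add: st_cut_def)
  have hle: "?h \<le> cap C" if "is_cut C" "x \<notin> C" for C
    using k(2) that by (cases x rule: avoiding_cases) (auto simp: decrement_word_Suc)
  have gle: "?g \<le> cap C" if "is_cut C" "y \<in> C" for C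
    using xy(2) k(3) that by (cases y rule: containing_cases) (auto simp: decrement_word_Suc)
  have "min (min (min ?f ?h) ?g) ?m \<le> ?cap' C" if C: "is_cut C" for C
  proof (cases "x \<in> C \<and> y \<notin> C")
    case False
    then have "int (?cap' C) = int (cap C)" using cap'[OF C] by auto
    then show ?thesis using False hle[OF C] gle[OF C] by (auto simp: min_le_iff_disj)
  next
    case True
    then have c: "int (?cap' C) = int (cap C) + \<Delta>" using cap'[OF C] by simp
    have AC: "arc_cut (x, y) C" using C True by (simp add: arc_cut_def)
    show ?thesis
    proof (cases "0 \<le> \<Delta> \<or> int mincut \<le> int (cap C) + \<Delta>")
      case True
      then have "?f \<le> ?cap' C" using c mincut_le[OF C, of w] by auto
      then show ?thesis by (simp add: min_le_iff_disj)
    next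
      case False
      \<comment> \<open>Here \<open>\<Delta> < 0\<close>, and
        \<open>cap C < mincut - \<Delta>\<close>, which is at most
        \<open>mincut + w (x, y)\<close>.\<close>
      then have "vital (x, y)" using AC arc \<Delta> by (auto simp: vital_def intro!: exI[of _ C])
      from decode_vertex_entries_vital[OF this AC] have "?m \<le> ?cap' C"
        using m c by linarith
      then show ?thesis by (simp add: min_le_iff_disj)
    qed
  qed
  then show "min (min (min ?f ?h) ?g) ?m \<le> ?M" using mincut_attained by metis
  have M: "int ?M \<le> int (?cap' C)" if "is_cut C" for C
    using mincut_le[OF that] by simp
  obtain C0 where C0: "is_cut C0" "cap C0 = mincut" using mincut_attained by blast
  have f: "?M \<le> ?f" and f2: "int ?M \<le> int mincut + \<Delta> \<or> int ?M \<le> int mincut"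
    using M[OF C0(1)] cap'[OF C0(1)] C0(2) by (auto split: if_splits)
  moreover have "?M \<le> ?h"
  proof (cases x rule: avoiding_cases)
    case none
    \<comment> \<open>Infinity is the word \<open>2 ^ k - 1\<close>, which is still at least
      \<open>mincut + nat \<Delta>\<close>.\<close>
    then show ?thesis using f k(1) by (simp add: decrement_word_0)
  next
    case (some C)
    then show ?thesis using M[of C] cap'[of C] k(2) by (simp add: decrement_word_Suc)
  qed
  moreover have "?M \<le> ?g"
    using xy(2)
  proof (cases y rule: containing_cases)
    case none
    then show ?thesis using f k(1) by (simp add: decrement_word_0)
  next
    case (some C)
    then show ?thesis using M[of C] cap'[of C] k(3) by (simp add: decrement_word_Suc)
  qed
  moreover have "int ?M \<le> int ?m"
    using decode_vertex_entries[OF xy]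
  proof (elim disjE exE conjE)
    assume "decode (vertex_entries x) (vertex_entries y) = mincut + max_capacity"
    then show ?thesis using m \<Delta> arc_le_max_capacity[OF arc] f by simp
  next
    fix C assume "arc_cut (x, y) C" "cap C = decode (vertex_entries x) (vertex_entries y)"
    then show ?thesis using M[of C] cap'[of C] m by (simp add: arc_cut_def)
  qed
  ultimately show "?M \<le> min (min (min ?f ?h) ?g) ?m" by simp
qed


section \<open>Size bounds and correctness\<close>

lemma card_arcs: "card (parcs G) \<le> card (pverts G) ^ 2"
proof -
  have "card (parcs G) \<le> card (pverts G \<times> pverts G)"
    using finite_verts arc_verts by (intro card_mono) auto
  then show ?thesis by (simp add: card_cartesian_product power2_eq_square)
qed

lemma cap_le: "cap C \<le> card (pverts G) ^ 2 * max_capacity"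
proof -
  have "cap C \<le> sum w (parcs G)"
    unfolding cut_capacity_def using finite_arcs by (intro sum_mono2) auto
  also have "\<dots> \<le> card (parcs G) * max_capacity"
    using arc_le_max_capacity by (metis id_apply of_nat_eq_id sum_bounded_above)
  finally show ?thesis using card_arcs mult_le_mono1 order_trans by blast
qed

lemma mincut_bound: "mincut \<le> card (pverts G) ^ 2 * max_capacity"
  using mincut_le[OF cut_source, of w] cap_le order_trans by blast

text \<open>The program reads cells \<open>0\<close> and \<open>1\<close> of the tail's label and
  cell \<open>2\<close> of the head's; a vertex can play either role.\<close>

definition cells :: "'a \<Rightarrow> nat list" where
  "cells v = [mincut, avoiding v, containing v] @ concat (map entry_cells (vertex_entries v))"

text \<open>The factor \<open>2\<close> absorbs the offset \<open>1\<close> and the summand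
  \<open>max_capacity\<close> of the default; indices are at most the number of arcs.\<close>

lemma cells_bound:
  assumes "0 < max_capacity" "v \<in> pverts G" "u \<in> set (cells v)"
  shows "u \<le> 2 * (card (pverts G) ^ 2 * max_capacity)"
proof -
  let ?B = "card (pverts G) ^ 2 * max_capacity"
  have "card (pverts G) \<noteq> 0" using assms(2) finite_verts by auto
  then have B: "1 \<le> ?B" "max_capacity \<le> ?B" "card (pverts G) ^ 2 \<le> ?B" using assms(1) by auto
  have "avoiding v \<le> Suc ?B"
    by (cases v rule: avoiding_cases) (use cap_le in auto)
  moreover have "containing v \<le> Suc ?B"
    using assms(2) by (cases v rule: containing_cases) (use cap_le in auto)
  moreover have "i \<le> 2 * ?B \<and> a \<le> 2 * ?B \<and> b \<le> 2 * ?B" if "(i, a, b) \<in> set (vertex_entries v)" for i a b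
  proof -
    have le: "d \<le> 2 * ?B" if "d \<in> insert (mincut + max_capacity) (cap ` set vital_cuts)" for d
    proof -
      have "d \<le> ?B \<or> d = mincut + max_capacity" using that cap_le by blast
      then show ?thesis using B mincut_bound by linarith
    qed
    have "i \<le> card (parcs G)"
      using entries_mem that vital_cuts(1) unfolding vertex_entries_def by (metis order_trans)
    then have "i \<le> 2 * ?B" using card_arcs B by linarith
    then show ?thesis using entries_mem[OF that[unfolded vertex_entries_def]] le by blast
  qed
  moreover have "u \<in> {mincut, avoiding v, containing v} \<or>
      (\<exists>i a b. (i, a, b) \<in> set (vertex_entries v) \<and> u \<in> {i, a, b})"
    using assms(3) by (force simp: cells_def)
  moreover have "mincut \<le> 2 * ?B" "Suc ?B \<le> 2 * ?B" using mincut_bound B(1) by linarith+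
  ultimately show ?thesis by (blast intro: order_trans)
qed

lemma two_le_card: "2 \<le> card (pverts G)"
proof -
  have "card {s, t} \<le> card (pverts G)" using s t finite_verts by (intro card_mono) auto
  then show ?thesis using st by simp
qed

lemma length_vertex_entries:
  assumes "v \<in> pverts G"
  shows "length (vertex_entries v) \<le> floorlog 2 (card (pverts G))"
proof -
  have "2 ^ length (vertex_entries v) \<le> 2 * card (pverts G)"
    unfolding vertex_entries_def using finite_verts assms by (rule length_entries)
  also have "\<dots> < 2 ^ Suc (floorlog 2 (card (pverts G)))"
    using less_power_floorlog by simp
  finally have "length (vertex_entries v) < Suc (floorlog 2 (card (pverts G)))"
    by (rule power_less_imp_less_exp[rotated]) simp
  then show ?thesis by simp
qed

lemma length_cells: "length (cells v) = 3 + 3 * length (vertex_entries v)"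
  by (simp add: cells_def length_concat_entry_cells)

text \<open>One bit for the factor \<open>2\<close>, two lengths of \<open>n\<close> and one of
  \<open>W\<close> fit into four times the sum of both lengths.\<close>

lemma bound_less:
  assumes "0 < max_capacity"
  shows "2 * (card (pverts G) ^ 2 * max_capacity) < 2 ^ block_length 4 (card (pverts G)) max_capacity"
proof -
  let ?n = "card (pverts G)"
  have "2 * (?n ^ 2 * max_capacity) < 2 * ((2 ^ floorlog 2 ?n) ^ 2 * 2 ^ floorlog 2 max_capacity)"
    using less_power_floorlog[of ?n] less_power_floorlog[of max_capacity] assms(1) two_le_card
    by (intro mult_strict_left_mono mult_strict_mono power_strict_mono) auto
  also have "\<dots> = 2 ^ (1 + 2 * floorlog 2 ?n + floorlog 2 max_capacity)"
    by (simp add: power_add power_mult[symmetric] mult.commute)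
  also have "\<dots> \<le> 2 ^ block_length 4 ?n max_capacity"
    using two_le_card by (intro power_increasing) (auto simp: block_length_def floorlog_def)
  finally show ?thesis .
qed

lemma query_correct:
  assumes arc: "(x, y) \<in> parcs G" and \<Delta>: "- int (w (x, y)) \<le> \<Delta>" and pos: "0 < w (x, y)"
    and b: "b = block_length 4 (card (pverts G)) max_capacity"
    and k: "b + floorlog 2 (nat \<bar>\<Delta>\<bar>) \<le> k"
  shows "\<exists>T\<le>7 * floorlog 2 (card (pverts G)) + 22.
     outputs k query_program
       (query_state k b (encode_cells b (cells x)) (encode_cells b (cells y)) \<Delta>) T
       (mincut_capacity G (change_capacity w (x, y) \<Delta>) s t)"
proof -
  let ?n = "card (pverts G)"
  have xy: "x \<in> pverts G" "y \<in> pverts G" using arc_verts[OF arc] by auto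
  have W: "0 < max_capacity" using pos arc_le_max_capacity[OF arc] by linarith
  have N: "1 \<le> floorlog 2 ?n" "1 \<le> floorlog 2 max_capacity"
    using two_le_card W by (auto simp: floorlog_def)
  then have b0: "0 < b" by (simp add: b block_length_def)
  have less: "u < 2 ^ b" if "u \<in> set (cells x) \<union> set (cells y)" for u
    using that cells_bound[OF W] bound_less[OF W] xy b by (meson UnE le_less_trans)
  have packs: "pack b (encode_cells b (cells x)) = cells x" "pack b (encode_cells b (cells y)) = cells y"
    using less by (intro pack_encode_cells b0; auto)+
  have bk: "(2::nat) ^ b \<le> 2 ^ k" using k by (intro power_increasing) auto
  have dk: "nat \<bar>\<Delta>\<bar> < 2 ^ k"
    using less_power_floorlog[of "nat \<bar>\<Delta>\<bar>"] k
      power_increasing[of "floorlog 2 (nat \<bar>\<Delta>\<bar>)" k "2::nat"] by linarith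
  \<comment> \<open>\<open>u + nat \<Delta> + 1\<close> is at most
    \<open>(u + 1) * (nat \<Delta> + 1)\<close>, whose factors fit into the two summands of the
    bound on \<open>k\<close>.\<close>
  have plus: "u + nat \<Delta> < 2 ^ k" if "u < 2 ^ b" for u :: nat
  proof -
    let ?q = "floorlog 2 (nat \<bar>\<Delta>\<bar>)"
    have "nat \<Delta> + 1 \<le> 2 ^ ?q" using less_power_floorlog[of "nat \<bar>\<Delta>\<bar>"] by linarith
    moreover have "u + 1 \<le> 2 ^ b" using that by simp
    ultimately have "(u + 1) * (nat \<Delta> + 1) \<le> 2 ^ b * 2 ^ ?q" by (rule mult_le_mono[rotated])
    also have "\<dots> \<le> 2 ^ k" using k by (simp flip: power_add)
    finally show ?thesis by (simp add: algebra_simps)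
  qed
  let ?xs = "vertex_entries x" and ?ys = "vertex_entries y"
  have len: "length ?xs \<le> floorlog 2 ?n" "length ?ys \<le> floorlog 2 ?n"
    using length_vertex_entries xy by auto
  \<comment> \<open>Addresses must fit into a word: both labels together have at most
    \<open>6 + 6 * floorlog 2 ?n\<close> cells.\<close>
  have "12 * floorlog 2 ?n < 16 * 2 ^ floorlog 2 ?n"
    using less_exp[of "floorlog 2 ?n"] by linarith
  also have "\<dots> = 2 ^ (4 + floorlog 2 ?n)" by (simp add: power_add)
  also have "\<dots> \<le> 2 ^ b"
    unfolding b using N by (intro power_increasing) (auto simp: block_length_def)
  finally have size: "6 + 3 * length ?xs + 3 * length ?ys < 2 ^ k"
    using len N bk by linarith
  \<comment> \<open>\<open>q\<close> is the initial content of register \<open>0\<close> and the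
    address of the second label.\<close>
  define q where "q = 3 + 3 * length ?xs"
  define \<sigma> where "\<sigma> = query_state k b (encode_cells b (cells x)) (encode_cells b (cells y)) \<Delta>"
  have mem: "mem \<sigma> i = (if i < length (cells x @ cells y) then (cells x @ cells y) ! i else 0)" for i
  proof -
    have "(cells x @ cells y) ! i < 2 ^ k" if "i < length (cells x @ cells y)"
      using less[of "(cells x @ cells y) ! i"] nth_mem[OF that] bk
      unfolding set_append by linarith
    then show ?thesis
      unfolding \<sigma>_def query_state_def packs by (simp add: Let_def take_bit_nat_eq_self)
  qed
  have reg: "reg \<sigma> 0 = q" "reg \<sigma> 2 = nat \<Delta>" "reg \<sigma> 3 = nat (- \<Delta>)" "reg \<sigma> 4 = 0" "reg \<sigma> 9 = 0"
    using size dk unfolding \<sigma>_def query_state_def packs length_cells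
    by (auto simp: Let_def q_def nth_Cons' intro!: take_bit_nat_eq_self)
  have \<sigma>: "\<sigma> = \<lparr>pc = 0, reg = reg \<sigma>, mem = mem \<sigma>\<rparr>"
    by (simp add: \<sigma>_def query_state_def Let_def)
  have lens: "length (cells x) = q" "length (cells y) = 3 + 3 * length ?ys"
    by (simp_all add: length_cells q_def)
  have m0: "mem \<sigma> 0 = mincut" "mem \<sigma> 1 = avoiding x" "mem \<sigma> (q + 2) = containing y"
    unfolding mem by (auto simp: nth_append lens q_def) (simp_all add: cells_def)
  have ex: "entries_at (mem \<sigma>) 3 ?xs"
    by (rule entries_at_nth) (auto simp: mem nth_append lens q_def, simp add: cells_def)
  have ey: "entries_at (mem \<sigma>) (q + 3) ?ys"
    by (rule entries_at_nth) (auto simp: mem nth_append lens, simp add: cells_def)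
  have set: "mincut \<in> set (cells x)" "avoiding x \<in> set (cells x)" "containing y \<in> set (cells y)"
    by (auto simp: cells_def)
  have "0 < card (pverts G) ^ 2" using two_le_card by simp
  then have "max_capacity \<le> card (pverts G) ^ 2 * max_capacity" by simp
  then have "decode ?xs ?ys \<le> 2 * (card (pverts G) ^ 2 * max_capacity)"
    using decode_vertex_entries[OF xy] mincut_bound cap_le by (metis add_mono mult_2 trans_le_add1)
  then have dec: "decode ?xs ?ys < 2 ^ b" using bound_less[OF W] unfolding b by linarith
  have "w (x, y) \<le> decode ?xs ?ys" using arc by (rule decode_ge)
  then have neg: "nat (- \<Delta>) \<le> decode ?xs ?ys + nat \<Delta>" using \<Delta> by linarith
  have k': "mincut + nat \<Delta> < 2 ^ k" "avoiding x < 2 ^ k" "containing y < 2 ^ k"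
    using plus[of mincut] less set bk by (blast intro: less_le_trans)+
  have "\<exists>T\<le>7 * length ?xs + 22. outputs k query_program \<lparr>pc = 0, reg = reg \<sigma>, mem = mem \<sigma>\<rparr> T
           (min (min (min (mincut + reg \<sigma> 2) (decrement_word k (avoiding x))) (decrement_word k (containing y)))
             (decode ?xs ?ys + reg \<sigma> 2 - reg \<sigma> 3))"
    by (rule query_program_run[OF reg(1,4,5) m0 ex ey])
      (use size k' plus[OF dec] neg in \<open>auto simp: reg q_def vertex_entries_def terminated_entries\<close>)
  then show ?thesis
    unfolding reg mincut_change[OF arc \<Delta> k'] \<sigma>[symmetric]
    using len(1) unfolding \<sigma>_def by (meson add_le_mono1 mult_le_mono2 order_trans)
qed

end

theorem theorem11:
  shows "\<exists>(P :: instr list) (c :: nat) (d :: nat) (K :: real).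
    \<forall>(G :: 'a pair_pre_digraph) (w :: 'a \<times> 'a \<Rightarrow> nat) (s :: 'a) (t :: 'a) (n :: nat) (W :: nat).
      pair_fin_digraph G \<and> (\<forall>e \<in> parcs G. 0 < w e) \<and>
      s \<in> pverts G \<and> t \<in> pverts G \<and> s \<noteq> t \<and>
      n = card (pverts G) \<and> W = Max (w ` parcs G) \<longrightarrow>
      (\<exists>lab :: 'a \<Rightarrow> bool list.
        (\<forall>v \<in> pverts G.
           real (length (lab v)) \<le> K * ((log 2 n)\<^sup>2 + log 2 n * log 2 W)) \<and>
        (\<forall>(x :: 'a) (y :: 'a) (\<Delta> :: int) (k :: nat).
           (x, y) \<in> parcs G \<and> - int (w (x, y)) \<le> \<Delta> \<and>
           block_length c n W + floorlog 2 (nat \<bar>\<Delta>\<bar>) \<le> k \<longrightarrow>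
           (\<exists>T :: nat. real T \<le> K * (log 2 n) ^ d \<and>
              outputs k P (query_state k (block_length c n W) (lab x) (lab y) \<Delta>) T
                (mincut_capacity G (change_capacity w (x, y) \<Delta>) s t))))"
\<comment> \<open>With \<open>L = log 2 n\<close> and \<open>M = log 2 W\<close>, labels have at
  most \<open>9 * L\<close> cells of at most \<open>4 * (3 * L + M)\<close> bits, hence
  \<open>108\<close>. The time is at most \<open>14 * L + 22\<close>, which is covered as
  \<open>1 \<le> L\<close>.\<close>
proof (rule exI[of _ query_program], rule exI[of _ 4], rule exI[of _ 1], rule exI[of _ 108],
    intro allI impI, elim conjE)
  fix G :: "'a pair_pre_digraph" and w :: "'a \<times> 'a \<Rightarrow> nat" and s t n W
  assume G: "pair_fin_digraph G" "\<forall>e \<in> parcs G. 0 < w e" "s \<in> pverts G" "t \<in> pverts G" "s \<noteq> t"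
    and n: "n = card (pverts G)" and W: "W = Max (w ` parcs G)"
  interpret st_network G w s t using G by (intro st_network.intro)
  have WM: "W = max_capacity" by (simp add: W max_capacity_def)
  define L where "L = log 2 n"
  define M where "M = log 2 W"
  have L: "1 \<le> L" using two_le_card by (simp add: L_def n)
  have N: "real (floorlog 2 n) \<le> 2 * L"
    using real_floorlog_le[of n] two_le_card L unfolding L_def n by linarith
  show "\<exists>lab :: 'a \<Rightarrow> bool list.
        (\<forall>v \<in> pverts G.
           real (length (lab v)) \<le> 108 * ((log 2 n)\<^sup>2 + log 2 n * log 2 W)) \<and>
        (\<forall>(x :: 'a) (y :: 'a) (\<Delta> :: int) (k :: nat).
           (x, y) \<in> parcs G \<and> - int (w (x, y)) \<le> \<Delta> \<and>
           block_length 4 n W + floorlog 2 (nat \<bar>\<Delta>\<bar>) \<le> k \<longrightarrow>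
           (\<exists>T :: nat. real T \<le> 108 * (log 2 n) ^ 1 \<and>
              outputs k query_program (query_state k (block_length 4 n W) (lab x) (lab y) \<Delta>) T
                (mincut_capacity G (change_capacity w (x, y) \<Delta>) s t)))"
  proof (cases "parcs G = {}")
    case True
    \<comment> \<open>\<open>W\<close> is now the maximum of the empty set, but some natural number;
      empty labels suffice because there are no queries.\<close>
    have "0 \<le> M" by (cases "W = 0") (auto simp: M_def log_def)
    then show ?thesis using L True by (intro exI[of _ "\<lambda>_. []"]) (simp add: L_def M_def)
  next
    case False
    then have "0 < W" using G(2) finite_arcs by (auto simp: W Max_gr_iff)
    \<comment> \<open>The rounding term \<open>1\<close> is charged to \<open>L\<close>, since
      \<open>M\<close> may be \<open>0\<close>.\<close>
    then have Q: "real (floorlog 2 W) \<le> M + L" and M: "0 \<le> M"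
      using real_floorlog_le[of W] L by (auto simp: M_def)
    define b where "b = block_length 4 n W"
    have "real (length (encode_cells b (cells v))) \<le> 108 * (L\<^sup>2 + L * M)" if v: "v \<in> pverts G" for v
    proof -
      have "real (length (vertex_entries v)) \<le> 2 * L"
        using length_vertex_entries[OF v] N by (simp add: n)
      then have "real (length (cells v)) \<le> 9 * L" using L by (simp add: length_cells)
      moreover have "real b \<le> 4 * (3 * L + M)"
        using N Q by (simp add: b_def block_length_def)
      ultimately have "real b * real (length (cells v)) \<le> 4 * (3 * L + M) * (9 * L)"
        using L M by (intro mult_mono) auto
      also have "\<dots> \<le> 108 * (L\<^sup>2 + L * M)"
        using L M by (simp add: algebra_simps power2_eq_square)
      finally show ?thesis by (simp add: length_encode_cells)
    qed
    moreover have "\<exists>T. real T \<le> 108 * L ^ 1 \<and>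
        outputs k query_program
          (query_state k b (encode_cells b (cells x)) (encode_cells b (cells y)) \<Delta>) T
          (mincut_capacity G (change_capacity w (x, y) \<Delta>) s t)"
      if query: "(x, y) \<in> parcs G" "- int (w (x, y)) \<le> \<Delta>" "b + floorlog 2 (nat \<bar>\<Delta>\<bar>) \<le> k"
      for x y \<Delta> k
    proof -
      have pos: "0 < w (x, y)" using G(2) query(1) by blast
      have b: "b = block_length 4 (card (pverts G)) max_capacity" by (simp add: b_def n WM)
      obtain T where T: "T \<le> 7 * floorlog 2 n + 22" "outputs k query_program
          (query_state k b (encode_cells b (cells x)) (encode_cells b (cells y)) \<Delta>) T
          (mincut_capacity G (change_capacity w (x, y) \<Delta>) s t)"
        using query_correct[OF query(1,2) pos b query(3)] unfolding n by blast
      have "real T \<le> 7 * real (floorlog 2 n) + 22" using T(1) by linarith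
      then have "real T \<le> 108 * L ^ 1" using N L by simp
      then show ?thesis using T(2) by blast
    qed
    ultimately show ?thesis
      unfolding L_def[symmetric] M_def[symmetric] b_def[symmetric]
      by (intro exI[of _ "\<lambda>v. encode_cells b (cells v)"]) blast
  qed
qed

end
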